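(* Let $S=(X,\prec,\sqsubset)$ be a finite so-structure and let $\lhd\in ext(S)$. Then (1) $S_{[\Omega_\lhd]}=S^{\{\Omega_\lhd\}}=S^{\{\lhd\}}=S$, and (2) $\mathfrak{C}(S)=[\Omega_\lhd]$, where $[\,\cdot\,]$ is the comtrace congruence class with respect to $\theta_S$.
   Context: Relations: $R^*$ is reflexive transitive closure, $\circ$ composition ($R\circ S=\{(x,y):\exists z.\,xRz\wedge zSy\}$), $R^{-1}$ inverse. For $(X,R_1,R_2)$, $(X,R_1,R_2)^\lozenge=(X,(R_1\cup R_2)^*\circ R_1\circ(R_1\cup R_2)^*,(R_1\cup R_2)^*\setminus\mathrm{id}_X)$. A stratified order on $X$ is an irreflexive transitive $\lhd$ for which $a\simeq_\lhd b\iff(a=b\vee(\neg a\lhd b\wedge\neg b\lhd a))$ is an equivalence; $\alpha\lhd^\frown\beta$ iff $\alpha\ne\beta\wedge\neg(\beta\lhd\alpha)$; $\Omega_\lhd=B_1\dots B_k$ is the sequence of $\simeq_\lhd$-classes ordered so that $\lhd=\bigcup_{i<j}B_i\times B_j$. An so-structure is $(X,\prec,\sqsubset)$ with, for all $a,b,c$: $\neg(a\sqsubset a)$; $a\prec b\Rightarrow a\sqsubset b$; $a\sqsubset b\sqsubset c\wedge a\ne c\Rightarrow a\sqsubset c$; $(a\sqsubset b\prec c\vee a\prec b\sqsubset c)\Rightarrow a\prec c$. $ext(S)$ is the set of stratified orders $\lhd$ on $X$ with $a\prec b\Rightarrow a\lhd b$ and $a\sqsubset b\Rightarrow a\lhd^\frown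 b$. Write $a\frown_\prec b$ iff $a\ne b\wedge\neg(a\prec b)\wedge\neg(b\prec a)$. Comtraces: a comtrace alphabet is $(E,sim,ser)$ with $E$ finite, $sim$ irreflexive symmetric, $ser\subseteq sim$. Steps $\mathbb{S}$: nonempty $A\subseteq E$ pairwise in $sim$. The comtrace congruence $\equiv$ on $\mathbb{S}^*$ is the equivalence generated by pairs $(wAz,wBCz)$ with $A,B,C\in\mathbb{S}$, $A=B\cup C$, $B\times C\subseteq ser$. For $u=A_1\dots A_k$: the event occurrences are $e^{(m+1)}$ for $e\in A_i$ with $m$ the number of $j<i$ with $e\in A_j$; $\Sigma_u$ their set; $l(e^{(j)})=e$; $pos_u(\alpha)$ the index of the step containing $\alpha$; $\alpha\lhd_u\beta$ iff $pos_u(\alpha)<pos_u(\beta)$; $\alpha\lhd_u^\frown\beta$ iff $\alpha\ne\beta\wedge pos_u(\alpha)\le pos_u(\beta)$. Define $\alpha\prec_u\beta$ iff $\alpha\lhd_u\beta\wedge(l(\alpha),l(\beta))\notin ser$, $\alpha\sqsubset_u\beta$ iff $\alpha\lhd_u^\frown\beta\wedge(l(\beta),l(\alpha))\notin ser$; $S^{\{u\}}=(\Sigma_u,\prec_u,\sqsubset_u)^\lozenge$ and $S_{[u]}=(\Sigma_u,\bigcap_{x\in[u]}\lhd_x,\bigcap_{x\in[u]}\lhd_x^\frown)$. Constructions from $S$: $(a,b)\in sim_S$ iff $a\frown_\prec b$; $(a,b)\in ser_S$ iff $a\frown_\prec b\wedge\neg(b\sqsubset a)$; $\theta_S=(X,sim_S,ser_S)$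 is a comtrace alphabet; for $\lhd\in ext(S)$, $\Omega_\lhd$ is a step sequence over $\theta_S$ in which each element of $X$ occurs once, so $x^{(1)}$ is identified with $x$ and $\Sigma_{\Omega_\lhd}=X$. $S^{\{\lhd\}}=(X,\lhd\setminus ser_S,\lhd^\frown\setminus ser_S^{-1})$ and $\mathfrak{C}(S)=\{\Omega_{\lhd'}:\lhd'\in ext(S)\}$. *)

theory Defs
  imports Main
begin

type_synonym 'a relstruct = "'a set \<times> 'a rel \<times> 'a rel"

definition carrier :: "'a relstruct \<Rightarrow> 'a set" where
  "carrier S = fst S"

text \<open>
  The reflexive transitive closure of Isabelle/HOL is reflexive on the whole type, not only on the
  carrier.  For relations on \<open>X\<close> this makes no difference here: the diagonal is removed in
  the third component, and in the second one \<open>R\<^sub>1\<close> occurs as a factor.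
\<close>

fun lozenge :: "'a relstruct \<Rightarrow> 'a relstruct" where
  "lozenge (X, R\<^sub>1, R\<^sub>2) =
     (X, (R\<^sub>1 \<union> R\<^sub>2)\<^sup>* O R\<^sub>1 O (R\<^sub>1 \<union> R\<^sub>2)\<^sup>*, (R\<^sub>1 \<union> R\<^sub>2)\<^sup>* - Id)"

definition simeq :: "'a set \<Rightarrow> 'a rel \<Rightarrow> 'a rel" where
  "simeq X lhd = {(a, b). a \<in> X \<and> b \<in> X \<and> (a = b \<or> ((a, b) \<notin> lhd \<and> (b, a) \<notin> lhd))}"

definition stratified_order :: "'a set \<Rightarrow> 'a rel \<Rightarrow> bool" where
  "stratified_order X lhd \<longleftrightarrow>
     lhd \<subseteq> X \<times> X \<and> irrefl lhd \<and> trans lhd \<and> equiv X (simeq X lhd)"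

text \<open>The relation \<open>lhd\<^sup>\<frown>\<close>, ``less than or incomparable to, and distinct from''.\<close>

definition weak :: "'a set \<Rightarrow> 'a rel \<Rightarrow> 'a rel" where
  "weak X lhd = {(a, b). a \<in> X \<and> b \<in> X \<and> a \<noteq> b \<and> (b, a) \<notin> lhd}"

definition blocks_order :: "'a set list \<Rightarrow> 'a rel" where
  "blocks_order Bs = (\<Union>j < length Bs. \<Union>i < j. (Bs ! i) \<times> (Bs ! j))"

definition Omega :: "'a set \<Rightarrow> 'a rel \<Rightarrow> 'a set list" where
  "Omega X lhd =
     (THE Bs. distinct Bs \<and> set Bs = X // simeq X lhd \<and> lhd = blocks_order Bs)"

text \<open>The definite description is proper on finite carriers.\<close>

lemma blocks_order_iff:
  "(a, b) \<in> blocks_order Bs \<longleftrightarrow> (\<exists>i j. i < j \<and> j < length Bs \<and> a \<in> Bs ! i \<and> b \<in> Bs ! j)"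
  by (auto simp: blocks_order_def)

lemma simeq_iff: "(a, b) \<in> simeq X lhd \<longleftrightarrow> a \<in> X \<and> b \<in> X \<and> (a = b \<or> ((a, b) \<notin> lhd \<and> (b, a) \<notin> lhd))"
  by (auto simp: simeq_def)

lemma Omega_ex1:
  assumes fin: "finite X" and so: "stratified_order X lhd"
  shows "\<exists>!Bs. distinct Bs \<and> set Bs = X // simeq X lhd \<and> lhd = blocks_order Bs"
proof -
  let ?r = "simeq X lhd" and ?Q = "X // simeq X lhd"
  let ?f = "\<lambda>A. card {x. \<exists>a\<in>A. (x, a) \<in> lhd}"
  have eq: "equiv X ?r" and sub: "lhd \<subseteq> X \<times> X" and irr: "irrefl lhd" and tr: "trans lhd"
    using so by (auto simp: stratified_order_def)
  have asym: "(b, a) \<notin> lhd" if "(a, b) \<in> lhd" for a b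
    using irr tr that by (meson irreflD transD)
  have finQ: "finite ?Q"
    using fin by (rule finite_quotient) (auto simp: simeq_def)
  have cls: "a \<in> X" "(a, a') \<in> ?r" if "A \<in> ?Q" "a \<in> A" "a' \<in> A" for A a a'
    using that eq in_quotient_imp_in_rel[OF eq that(1)] in_quotient_imp_subset[OF eq that(1)] by auto
  have ne: "A \<noteq> {}" if "A \<in> ?Q" for A
    using in_quotient_imp_non_empty[OF eq that] .
  have diffcls: "(a, b) \<notin> ?r" if "A \<in> ?Q" "B \<in> ?Q" "a \<in> A" "b \<in> B" "A \<noteq> B" for A B a b
    using quotient_eqI[OF eq that(1,2,3,4)] that(5) by blast
  have mono: "?f A < ?f B" if "A \<in> ?Q" "B \<in> ?Q" "a \<in> A" "b \<in> B" "(a, b) \<in> lhd" for A B a b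
  proof (rule psubset_card_mono)
    show "finite {x. \<exists>a\<in>B. (x, a) \<in> lhd}"
      by (rule finite_subset[OF _ fin]) (use sub in auto)
    have "(x, b) \<in> lhd" if "(x, a') \<in> lhd" "a' \<in> A" for x a'
    proof (rule ccontr)
      assume n: "(x, b) \<notin> lhd"
      have "(a', a) \<in> ?r" using cls that \<open>A \<in> ?Q\<close> \<open>a \<in> A\<close> by blast
      moreover have X: "x \<in> X" "b \<in> X" using that sub \<open>(a,b) \<in> lhd\<close> by auto
      moreover have "(a', b) \<notin> lhd" using n that tr by (meson transD)
      moreover have "(b, a') \<notin> lhd" 
      proof
        assume "(b, a') \<in> lhd"
        then have "(a, a') \<in> lhd" using \<open>(a,b) \<in> lhd\<close> tr by (meson transD)
        with \<open>(a', a) \<in> ?r\<close> asym irr show False by (auto simp: simeq_iff irrefl_def)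
      qed
      ultimately have "(a', b) \<in> ?r" by (auto simp: simeq_iff)
      with \<open>(a', a) \<in> ?r\<close> eq have "(a, b) \<in> ?r" by (meson equivE symD transD)
      with \<open>(a,b) \<in> lhd\<close> irr show False by (auto simp: simeq_iff irrefl_def)
    qed
    moreover have "(a, b) \<in> lhd" by fact
    moreover have "(a, a') \<notin> lhd" if "a' \<in> A" for a'
      using cls(2)[OF \<open>A \<in> ?Q\<close> \<open>a \<in> A\<close> that] irr by (auto simp: simeq_iff irrefl_def)
    ultimately show "{x. \<exists>a\<in>A. (x, a) \<in> lhd} \<subset> {x. \<exists>a\<in>B. (x, a) \<in> lhd}"
      using \<open>b \<in> B\<close> by blast
  qed
  have tot: "(a, b) \<in> lhd \<or> (b, a) \<in> lhd" if "A \<in> ?Q" "B \<in> ?Q" "a \<in> A" "b \<in> B" "A \<noteq> B" for A B a b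
    using diffcls[OF that] cls(1)[OF that(1,3)] cls(1)[OF that(2,4)] that by (auto simp: simeq_iff)
  have inj: "inj_on ?f ?Q"
  proof (rule inj_onI, rule ccontr)
    fix A B assume AB: "A \<in> ?Q" "B \<in> ?Q" "?f A = ?f B" "A \<noteq> B"
    obtain a b where ab: "a \<in> A" "b \<in> B" using ne[OF AB(1)] ne[OF AB(2)] by blast
    show False
      using tot[OF AB(1,2) ab AB(4)] mono[OF AB(1,2) ab] mono[OF AB(2,1) ab(2,1)] AB(3) by auto
  qed
  have key: "(a, b) \<in> lhd" if "A \<in> ?Q" "B \<in> ?Q" "a \<in> A" "b \<in> B" "?f A < ?f B" for A B a b
  proof (rule ccontr)
    assume n: "(a, b) \<notin> lhd"
    have "A \<noteq> B" using that(5) by blast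
    with tot[OF that(1-4)] n have "(b, a) \<in> lhd" by blast
    from mono[OF that(2,1,4,3) this] that(5) show False by simp
  qed
  have char: "distinct Bs \<and> set Bs = ?Q \<and> lhd = blocks_order Bs
      \<longleftrightarrow> set Bs = ?Q \<and> sorted_wrt (<) (map ?f Bs)" (is "?L \<longleftrightarrow> ?R") for Bs
  proof
    assume L: ?L
    then have setBs: "set Bs = ?Q" and lhd: "lhd = blocks_order Bs" by blast+
    have "?f (Bs ! i) < ?f (Bs ! j)" if ij: "i < j" "j < length Bs" for i j
    proof -
      have "i < length Bs" using ij by simp
      then have Q: "Bs ! i \<in> ?Q" "Bs ! j \<in> ?Q"
        using nth_mem[of i Bs] nth_mem[OF ij(2)] unfolding setBs by blast+
      obtain a b where ab: "a \<in> Bs ! i" "b \<in> Bs ! j" using ne[OF Q(1)] ne[OF Q(2)] by blast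
      with ij have "(a, b) \<in> blocks_order Bs" unfolding blocks_order_iff by blast
      then have "(a, b) \<in> lhd" using lhd by (rule ssubst[rotated])
      then show ?thesis by (rule mono[OF Q ab])
    qed
    then have "sorted_wrt (<) (map ?f Bs)" by (simp add: sorted_wrt_iff_nth_less)
    with setBs show ?R by blast
  next
    assume R: ?R
    have srt: "?f (Bs ! i) < ?f (Bs ! j)" if "i < j" "j < length Bs" for i j
      using R that by (auto simp: sorted_wrt_iff_nth_less)
    have Q: "Bs ! i \<in> ?Q" if "i < length Bs" for i using R that nth_mem by blast
    have "distinct Bs" using R strict_sorted_iff[of "map ?f Bs"] by (simp add: distinct_map)
    moreover have "lhd = blocks_order Bs"
    proof (intro set_eqI iffI; clarify)
      fix a b assume ab: "(a, b) \<in> lhd"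
      then have "a \<in> \<Union>?Q" "b \<in> \<Union>?Q" using sub unfolding Union_quotient[OF eq] by blast+
      then obtain A B where A: "A \<in> ?Q" "B \<in> ?Q" "a \<in> A" "b \<in> B" by blast
      then obtain i j where ij: "i < length Bs" "A = Bs ! i" "j < length Bs" "B = Bs ! j"
        using R by (metis in_set_conv_nth)
      have lt: "?f A < ?f B" using mono[OF A ab] .
      have "i < j"
      proof (rule ccontr)
        assume "\<not> i < j"
        then consider "i = j" | "j < i" by linarith
        then show False using lt ij srt[of j i] by cases auto
      qed
      with ij A show "(a, b) \<in> blocks_order Bs" unfolding blocks_order_iff by blast
    next
      fix a b assume "(a, b) \<in> blocks_order Bs"
      then obtain i j where ij: "i < j" "j < length Bs" "a \<in> Bs ! i" "b \<in> Bs ! j"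
        unfolding blocks_order_iff by blast
      show "(a, b) \<in> lhd"
        by (rule key[OF Q Q ij(3,4) srt[OF ij(1,2)]]) (use ij in auto)
    qed
    ultimately show ?L using R by blast
  qed
  interpret folding_insort_key "(\<le>)" "(<)" ?Q ?f
    by unfold_locales (rule inj)
  let ?L = "linorder.sorted_key_list_of_set (\<le>) ?f ?Q"
  have *: "(set Bs = ?Q \<and> sorted_wrt (<) (map ?f Bs)) \<longleftrightarrow> ?L = Bs" for Bs
  proof -
    have "length Bs = card ?Q" if "set Bs = ?Q" "sorted_wrt (<) (map ?f Bs)"
      using that strict_sorted_iff[of "map ?f Bs"] distinct_card[of Bs] by (simp add: distinct_map)
    then show ?thesis using sorted_key_list_of_set_unique[OF subset_refl finQ, of Bs] by blast
  qed
  show ?thesis unfolding char * by blast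
qed

fun so_structure :: "'a relstruct \<Rightarrow> bool" where
  "so_structure (X, prec, sq) \<longleftrightarrow>
     prec \<subseteq> X \<times> X \<and> sq \<subseteq> X \<times> X \<and>
     (\<forall>a\<in>X. (a, a) \<notin> sq) \<and>
     (\<forall>a\<in>X. \<forall>b\<in>X. (a, b) \<in> prec \<longrightarrow> (a, b) \<in> sq) \<and>
     (\<forall>a\<in>X. \<forall>b\<in>X. \<forall>c\<in>X. (a, b) \<in> sq \<and> (b, c) \<in> sq \<and> a \<noteq> c \<longrightarrow> (a, c) \<in> sq) \<and>
     (\<forall>a\<in>X. \<forall>b\<in>X. \<forall>c\<in>X.
        ((a, b) \<in> sq \<and> (b, c) \<in> prec) \<or> ((a, b) \<in> prec \<and> (b, c) \<in> sq) \<longrightarrow> (a, c) \<in> prec)"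

fun ext :: "'a relstruct \<Rightarrow> 'a rel set" where
  "ext (X, prec, sq) = {lhd. stratified_order X lhd \<and> prec \<subseteq> lhd \<and> sq \<subseteq> weak X lhd}"

text \<open>A comtrace alphabet \<open>(E, sim, ser)\<close> is carried by the same kind of triple.\<close>

type_synonym 'a calphabet = "'a set \<times> 'a rel \<times> 'a rel"

fun comtrace_alphabet :: "'a calphabet \<Rightarrow> bool" where
  "comtrace_alphabet (E, sim, ser) \<longleftrightarrow>
     finite E \<and> sim \<subseteq> E \<times> E \<and> irrefl sim \<and> sym sim \<and> ser \<subseteq> sim"

fun ser_of :: "'a calphabet \<Rightarrow> 'a rel" where
  "ser_of (E, sim, ser) = ser"

fun steps :: "'a calphabet \<Rightarrow> 'a set set" where
  "steps (E, sim, ser) = {A. A \<noteq> {} \<and> A \<subseteq> E \<and> pairwise (\<lambda>a b. (a, b) \<in> sim) A}"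

inductive comtrace_split :: "'a calphabet \<Rightarrow> 'a set list \<Rightarrow> 'a set list \<Rightarrow> bool"
  for \<theta> where
  "\<lbrakk>w \<in> lists (steps \<theta>); z \<in> lists (steps \<theta>);
    A \<in> steps \<theta>; B \<in> steps \<theta>; C \<in> steps \<theta>; A = B \<union> C; B \<times> C \<subseteq> ser_of \<theta>\<rbrakk>
   \<Longrightarrow> comtrace_split \<theta> (w @ [A] @ z) (w @ [B, C] @ z)"

definition comtrace :: "'a calphabet \<Rightarrow> 'a set list \<Rightarrow> 'a set list set" where
  "comtrace \<theta> u = {v \<in> lists (steps \<theta>). equivclp (comtrace_split \<theta>) u v}"

text \<open>
  The event occurrence \<open>e\<^sup>(\<^sup>j\<^sup>)\<close> is the pair \<open>(e, j)\<close>, with \<open>j\<close> counted from 1, so that the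
  label of an occurrence is its first component.  Positions in a step sequence are counted from 0;
  only their order matters.
\<close>

definition occurs_at :: "'a set list \<Rightarrow> 'a \<times> nat \<Rightarrow> nat \<Rightarrow> bool" where
  "occurs_at u \<alpha> i \<longleftrightarrow>
     i < length u \<and> fst \<alpha> \<in> u ! i \<and> snd \<alpha> = card {j. j < i \<and> fst \<alpha> \<in> u ! j} + 1"

definition occs :: "'a set list \<Rightarrow> ('a \<times> nat) set" where
  "occs u = {\<alpha>. \<exists>i. occurs_at u \<alpha> i}"

definition pos :: "'a set list \<Rightarrow> 'a \<times> nat \<Rightarrow> nat" where
  "pos u \<alpha> = (THE i. occurs_at u \<alpha> i)"

definition seq_lhd :: "'a set list \<Rightarrow> ('a \<times> nat) rel" where
  "seq_lhd u = {(\<alpha>, \<beta>). \<alpha> \<in> occs u \<and> \<beta> \<in> occs u \<and> pos u \<alpha> < pos u \<beta>}"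

definition seq_weak :: "'a set list \<Rightarrow> ('a \<times> nat) rel" where
  "seq_weak u = {(\<alpha>, \<beta>). \<alpha> \<in> occs u \<and> \<beta> \<in> occs u \<and> \<alpha> \<noteq> \<beta> \<and> pos u \<alpha> \<le> pos u \<beta>}"

definition seq_prec :: "'a calphabet \<Rightarrow> 'a set list \<Rightarrow> ('a \<times> nat) rel" where
  "seq_prec \<theta> u = {(\<alpha>, \<beta>). (\<alpha>, \<beta>) \<in> seq_lhd u \<and> (fst \<alpha>, fst \<beta>) \<notin> ser_of \<theta>}"

definition seq_sq :: "'a calphabet \<Rightarrow> 'a set list \<Rightarrow> ('a \<times> nat) rel" where
  "seq_sq \<theta> u = {(\<alpha>, \<beta>). (\<alpha>, \<beta>) \<in> seq_weak u \<and> (fst \<beta>, fst \<alpha>) \<notin> ser_of \<theta>}"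

text \<open>
  The three structures below are \<open>S\<^sup>{\<^sup>u\<^sup>}\<close>, \<open>S\<^sub>[\<^sub>u\<^sub>]\<close> and \<open>S\<^sup>{\<^sup>\<lhd>\<^sup>}\<close>; the last one depends on \<open>S\<close>
  through \<open>ser\<^sub>S\<close>.
\<close>

definition seq_struct :: "'a calphabet \<Rightarrow> 'a set list \<Rightarrow> ('a \<times> nat) relstruct" where
  "seq_struct \<theta> u = lozenge (occs u, seq_prec \<theta> u, seq_sq \<theta> u)"

definition comtrace_struct :: "'a calphabet \<Rightarrow> 'a set list \<Rightarrow> ('a \<times> nat) relstruct" where
  "comtrace_struct \<theta> u =
     (occs u, \<Inter>x \<in> comtrace \<theta> u. seq_lhd x, \<Inter>x \<in> comtrace \<theta> u. seq_weak x)"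

definition sim_so :: "'a relstruct \<Rightarrow> 'a rel" where
  "sim_so = (\<lambda>(X, prec, sq).
     {(a, b). a \<in> X \<and> b \<in> X \<and> a \<noteq> b \<and> (a, b) \<notin> prec \<and> (b, a) \<notin> prec})"

definition ser_so :: "'a relstruct \<Rightarrow> 'a rel" where
  "ser_so = (\<lambda>(X, prec, sq). {(a, b). (a, b) \<in> sim_so (X, prec, sq) \<and> (b, a) \<notin> sq})"

definition theta :: "'a relstruct \<Rightarrow> 'a calphabet" where
  "theta S = (carrier S, sim_so S, ser_so S)"

lemma comtrace_alphabet_theta:
  assumes "so_structure S" "finite (carrier S)"
  shows "comtrace_alphabet (theta S)"
  using assms
  by (cases S) (auto simp: theta_def carrier_def sim_so_def ser_so_def irrefl_def sym_def)

definition order_struct :: "'a relstruct \<Rightarrow> 'a rel \<Rightarrow> 'a relstruct" where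
  "order_struct S lhd = (carrier S, lhd - ser_so S, weak (carrier S) lhd - (ser_so S)\<inverse>)"

definition ext_sequences :: "'a relstruct \<Rightarrow> 'a set list set" where
  "ext_sequences S = Omega (carrier S) ` ext S"

text \<open>The copy of a structure on \<open>X\<close> obtained by identifying \<open>x\<close> with \<open>x\<^sup>(\<^sup>1\<^sup>)\<close>.\<close>

fun first_occurrences :: "'a relstruct \<Rightarrow> ('a \<times> nat) relstruct" where
  "first_occurrences (X, R\<^sub>1, R\<^sub>2) =
     ((\<lambda>x. (x, 1)) ` X,
      {((a, 1), (b, 1)) | a b. (a, b) \<in> R\<^sub>1},
      {((a, 1), (b, 1)) | a b. (a, b) \<in> R\<^sub>2})"

end

theory Submission
  imports Defs
begin

text \<open>
  A step sequence over \<open>\<theta>\<^sub>S\<close> that partitions \<open>X\<close> comes from an extension of \<open>S\<close> iff no element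
  of a later block is \<open>\<sqsubset>\<close>-below an element of an earlier one.  A split along \<open>B \<times> C \<subseteq> ser\<close>
  neither creates nor destroys this property.  Conversely, if \<open>u\<close> and \<open>v\<close> both have it, the
  first block of \<open>v\<close> can be split off the blocks of \<open>u\<close>, commuted to the front and merged there, so
  \<open>u \<equiv> v\<close> by induction; this gives (2).  Since \<open>\<lhd>\<close> minus \<open>ser\<close> is \<open>\<prec>\<close> and
  \<open>\<lhd>\<^sup>\<frown>\<close> minus the inverse of \<open>ser\<close> is \<open>\<sqsubset>\<close>, what is left of (1) is that \<open>S\<close> is the intersection
  of its extensions.  For this, an extension is rearranged along down-sets of \<open>\<sqsubset>\<close>: if not
  \<open>a \<sqsubset> b\<close>, the down-set of \<open>b\<close> is moved to the front, before \<open>a\<close>; if \<open>a \<sqsubset> b\<close> but not \<open>a \<prec> b\<close>, all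
  elements between \<open>a\<close> and \<open>b\<close> are squeezed into a single block.
\<close>

section \<open>Ordered partitions and the stratified orders they induce\<close>

text \<open>Disjointness is required between positions rather than between members of
  \<open>set u\<close>, so together with nonemptiness it also excludes repeated blocks.\<close>

definition ordered_partition :: "'a set \<Rightarrow> 'a set list \<Rightarrow> bool" where
  "ordered_partition X u \<longleftrightarrow> {} \<notin> set u \<and> sorted_wrt disjnt u \<and> \<Union>(set u) = X"

text \<open>\<open>f\<close> sends each element to the position of its block, so that
  \<open>blocks_order u\<close> becomes comparison of natural numbers.\<close>

definition block_index :: "'a set \<Rightarrow> 'a set list \<Rightarrow> ('a \<Rightarrow> nat) \<Rightarrow> bool" where
  "block_index X u f \<longleftrightarrow>
     (\<forall>a\<in>X. f a < length u) \<and> (\<forall>i<length u. \<forall>a. a \<in> u ! i \<longleftrightarrow> a \<in> X \<and> f a = i)"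

lemma block_indexD:
  assumes "block_index X u f"
  shows "a \<in> X \<Longrightarrow> f a < length u"
    and "i < length u \<Longrightarrow> a \<in> u ! i \<longleftrightarrow> a \<in> X \<and> f a = i"
  using assms by (auto simp: block_index_def)

lemma ordered_partition_block_index:
  assumes "ordered_partition X u"
  obtains f where "block_index X u f"
proof -
  have un: "\<Union>(set u) = X" and sw: "sorted_wrt disjnt u"
    using assms by (auto simp: ordered_partition_def)
  have "\<exists>i. i < length u \<and> a \<in> u ! i" if "a \<in> X" for a
    using that un by (metis UnionE in_set_conv_nth)
  then obtain f where f: "\<And>a. a \<in> X \<Longrightarrow> f a < length u \<and> a \<in> u ! f a" by metis
  have dj: "disjnt (u ! i) (u ! j)" if "i < length u" "j < length u" "i \<noteq> j" for i j
    using that sw by (metis disjnt_sym linorder_neqE_nat sorted_wrt_iff_nth_less)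
  have "a \<in> u ! i \<longleftrightarrow> a \<in> X \<and> f a = i" if "i < length u" for a i
  proof
    assume a: "a \<in> u ! i"
    then have "a \<in> X" using un that by (meson UnionI nth_mem subsetD equalityD1)
    then show "a \<in> X \<and> f a = i" using f dj[OF that, of "f a"] a by (metis disjnt_iff)
  qed (use f in blast)
  then have "block_index X u f" using f by (simp add: block_index_def)
  then show thesis by (rule that)
qed

lemma blocks_order_block_index:
  assumes "block_index X u f"
  shows "blocks_order u = {(a, b). a \<in> X \<and> b \<in> X \<and> f a < f b}"
proof -
  note f = block_indexD[OF assms]
  have "(a, b) \<in> blocks_order u \<longleftrightarrow> a \<in> X \<and> b \<in> X \<and> f a < f b" for a b
  proof
    assume "(a, b) \<in> blocks_order u"
    then obtain i j where ij: "i < j" "j < length u" "a \<in> u ! i" "b \<in> u ! j"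
      unfolding blocks_order_iff by blast
    moreover have "i < length u" using ij by simp
    ultimately show "a \<in> X \<and> b \<in> X \<and> f a < f b" using f(2) by auto
  next
    assume ab: "a \<in> X \<and> b \<in> X \<and> f a < f b"
    then have "a \<in> u ! f a" "b \<in> u ! f b" "f b < length u" using f by auto
    then show "(a, b) \<in> blocks_order u" using ab unfolding blocks_order_iff by blast
  qed
  then show ?thesis by auto
qed

text \<open>Two elements are unordered exactly when their indices agree, so \<open>simeq\<close> is
  the kernel of the index function on \<open>X\<close>.\<close>

lemma stratified_order_blocks_order:
  assumes "ordered_partition X u"
  shows "stratified_order X (blocks_order u)"
proof -
  obtain f where rk: "block_index X u f"
    using ordered_partition_block_index[OF assms] .
  note f = block_indexD[OF rk]
  show ?thesis
    unfolding blocks_order_block_index[OF rk]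
    by (auto simp: stratified_order_def irrefl_def simeq_def intro!: transI equivI refl_onI symI)
qed

text \<open>The class of \<open>a\<close> is the block at index \<open>f a\<close>, so
  \<open>u\<close> satisfies the definite description, and \<open>Omega_ex1\<close> gives
  uniqueness. Together with \<open>Omega_stratified_order\<close> this makes \<open>Omega X\<close>
  and \<open>blocks_order\<close> mutually inverse.\<close>

lemma Omega_blocks_order:
  assumes "finite X" and u: "ordered_partition X u"
  shows "Omega X (blocks_order u) = u"
proof -
  obtain f where rk: "block_index X u f"
    using ordered_partition_block_index[OF u] .
  note f = block_indexD[OF rk]
  have ne: "u ! i \<noteq> {}" if "i < length u" for i
    using u that by (metis nth_mem ordered_partition_def)
  have "distinct u"
    unfolding distinct_conv_nth using f(2) ne by (metis ex_in_conv)
  moreover have cls: "simeq X (blocks_order u) `` {a} = u ! f a" if "a \<in> X" for a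
    using that f unfolding blocks_order_block_index[OF rk] by (auto simp: simeq_def)
  have "set u = X // simeq X (blocks_order u)"
  proof (intro equalityI subsetI)
    fix A assume "A \<in> set u"
    then obtain i where i: "i < length u" "A = u ! i" by (metis in_set_conv_nth)
    with ne obtain a where "a \<in> u ! i" by blast
    then have "a \<in> X" "A = simeq X (blocks_order u) `` {a}" using cls f(2) i by auto
    then show "A \<in> X // simeq X (blocks_order u)" by (auto intro: quotientI)
  next
    fix A assume "A \<in> X // simeq X (blocks_order u)"
    then obtain a where "a \<in> X" "A = simeq X (blocks_order u) `` {a}" by (auto elim: quotientE)
    then show "A \<in> set u" using cls f(1) by auto
  qed
  ultimately show ?thesis
    unfolding Omega_def
    by (intro the1_equality[OF Omega_ex1[OF \<open>finite X\<close> stratified_order_blocks_order[OF u]]]) simp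
qed

lemma Omega_stratified_order:
  assumes "finite X" "stratified_order X lhd"
  shows "ordered_partition X (Omega X lhd)" "blocks_order (Omega X lhd) = lhd"
proof -
  let ?u = "Omega X lhd"
  have eq: "equiv X (simeq X lhd)" using assms(2) by (simp add: stratified_order_def)
  have u: "distinct ?u" "set ?u = X // simeq X lhd" "lhd = blocks_order ?u"
    using theI'[OF Omega_ex1[OF assms]] unfolding Omega_def[symmetric] by blast+
  show "blocks_order ?u = lhd" using u(3) by simp
  have "disjnt (?u ! i) (?u ! j)" if "i < j" "j < length ?u" for i j
  proof -
    have "?u ! i \<in> X // simeq X lhd" "?u ! j \<in> X // simeq X lhd"
      unfolding u(2)[symmetric] using that by auto
    moreover have "?u ! i \<noteq> ?u ! j" using that u(1) by (simp add: nth_eq_iff_index_eq)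
    ultimately show ?thesis using quotient_disj[OF eq] by (auto simp: disjnt_def)
  qed
  then have "sorted_wrt disjnt ?u" by (simp add: sorted_wrt_iff_nth_less)
  moreover have "{} \<notin> set ?u" "\<Union>(set ?u) = X"
    unfolding u(2) using in_quotient_imp_non_empty[OF eq] Union_quotient[OF eq] by blast+
  ultimately show "ordered_partition X ?u" by (simp add: ordered_partition_def)
qed

text \<open>This justifies identifying \<open>x\<close> with its first occurrence: no block before
  the one containing \<open>x\<close> contains \<open>x\<close>, so the counter is always 0 +
  1.\<close>

lemma
  assumes "ordered_partition X u"
  shows occs_ordered_partition: "occs u = (\<lambda>x. (x, 1)) ` X"
    and seq_lhd_ordered_partition:
      "seq_lhd u = {((a, 1), (b, 1)) |a b. (a, b) \<in> blocks_order u}"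
    and seq_weak_ordered_partition:
      "seq_weak u = {((a, 1), (b, 1)) |a b. (a, b) \<in> weak X (blocks_order u)}"
proof -
  obtain f where rk: "block_index X u f"
    using ordered_partition_block_index[OF assms] .
  note f = block_indexD[OF rk]
  have occ: "occurs_at u (a, n) i \<longleftrightarrow> a \<in> X \<and> f a = i \<and> n = 1" for a n i
  proof -
    have "{j. j < i \<and> a \<in> u ! j} = {}" if "i < length u" "a \<in> u ! i"
      using that f(2)[of _ a] by fastforce
    then have "occurs_at u (a, n) i \<longleftrightarrow> i < length u \<and> a \<in> u ! i \<and> n = 1"
      by (auto simp: occurs_at_def)
    then show ?thesis using f by blast
  qed
  have pos: "pos u (a, 1) = f a" if "a \<in> X" for a
    unfolding pos_def occ using that by auto
  show occs: "occs u = (\<lambda>x. (x, 1)) ` X"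
    unfolding occs_def using occ by auto
  show "seq_lhd u = {((a, 1), (b, 1)) |a b. (a, b) \<in> blocks_order u}"
    unfolding seq_lhd_def occs blocks_order_block_index[OF rk] using pos by auto
  show "seq_weak u = {((a, 1), (b, 1)) |a b. (a, b) \<in> weak X (blocks_order u)}"
    unfolding seq_weak_def occs blocks_order_block_index[OF rk] weak_def using pos by auto
qed

section \<open>So-structures and the lozenge operation\<close>

text \<open>Both relations live on \<open>X\<close>, so the axioms hold without membership premises,
  the form in which they are applied below.\<close>

lemma so_structureD:
  assumes S: "so_structure (X, prec, sq)"
  shows "prec \<subseteq> X \<times> X" "sq \<subseteq> X \<times> X" "(a, a) \<notin> sq" "prec \<subseteq> sq"
    and "(a, b) \<in> sq \<Longrightarrow> (b, c) \<in> sq \<Longrightarrow> a \<noteq> c \<Longrightarrow> (a, c) \<in> sq"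
    and "(a, b) \<in> sq \<Longrightarrow> (b, c) \<in> prec \<Longrightarrow> (a, c) \<in> prec"
    and "(a, b) \<in> prec \<Longrightarrow> (b, c) \<in> sq \<Longrightarrow> (a, c) \<in> prec"
proof -
  show sub: "prec \<subseteq> X \<times> X" "sq \<subseteq> X \<times> X"
    using S unfolding so_structure.simps by blast+
  show "(a, a) \<notin> sq" using S sub(2) unfolding so_structure.simps by blast
  show "prec \<subseteq> sq"
  proof clarify
    fix a b assume "(a, b) \<in> prec"
    moreover from this sub(1) have "a \<in> X" "b \<in> X" by auto
    ultimately show "(a, b) \<in> sq" using S unfolding so_structure.simps by blast
  qed
  have mem: "x \<in> X \<and> y \<in> X" if "(x, y) \<in> prec \<or> (x, y) \<in> sq" for x y
    using that sub by auto
  show "(a, c) \<in> sq" if "(a, b) \<in> sq" "(b, c) \<in> sq" "a \<noteq> c"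
    using that mem[of a b] mem[of b c] S unfolding so_structure.simps by blast
  show "(a, c) \<in> prec" if "(a, b) \<in> sq" "(b, c) \<in> prec"
    using that mem[of a b] mem[of b c] S unfolding so_structure.simps by blast
  show "(a, c) \<in> prec" if "(a, b) \<in> prec" "(b, c) \<in> sq"
    using that mem[of a b] mem[of b c] S unfolding so_structure.simps by blast
qed

text \<open>Since \<open>prec\<close> lies in \<open>sq\<close>, only \<open>sq\<close> is being
  closed. Transitivity off the diagonal lets the closure add nothing but the identity, and
  \<open>prec\<close> absorbs \<open>sq\<close> on either side.\<close>

lemma lozenge_so_structure:
  assumes S: "so_structure (X, prec, sq)"
  shows "lozenge (X, prec, sq) = (X, prec, sq)"
proof -
  note so = so_structureD[OF S]
  have un: "prec \<union> sq = sq" using so(4) by blast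
  have star: "a = b \<or> (a, b) \<in> sq" if "(a, b) \<in> sq\<^sup>*" for a b
    using that
  proof induction
    case (step y z)
    then show ?case using so(5)[of a y z] by auto
  qed simp
  have "sq\<^sup>* - Id = sq"
  proof (intro equalityI subrelI)
    fix a b assume "(a, b) \<in> sq"
    then show "(a, b) \<in> sq\<^sup>* - Id" using so(3)[of a] by auto
  qed (use star in auto)
  moreover have "sq\<^sup>* O prec O sq\<^sup>* = prec"
  proof (intro equalityI subrelI)
    fix a d assume "(a, d) \<in> sq\<^sup>* O prec O sq\<^sup>*"
    then obtain b c where "(a, b) \<in> sq\<^sup>*" "(b, c) \<in> prec" "(c, d) \<in> sq\<^sup>*" by auto
    then show "(a, d) \<in> prec" using star[of a b] star[of c d] so(6)[of a b] so(7)[of _ c d] by blast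
  qed auto
  ultimately show ?thesis by (simp add: un)
qed

lemma so_structure_first_occurrences:
  assumes "so_structure S"
  shows "so_structure (first_occurrences S)"
proof -
  obtain X prec sq where S: "S = (X, prec, sq)" by (cases S)
  note so = so_structureD[OF assms[unfolded S]]
  show ?thesis
    unfolding S first_occurrences.simps so_structure.simps
    by (intro conjI ballI impI; use so in blast)
qed

section \<open>Compatibility of the comtrace congruence with prefixing\<close>

lemma equivclp_map:
  assumes "\<And>x y. r x y \<Longrightarrow> equivclp s (h x) (h y)" and "equivclp r x y"
  shows "equivclp s (h x) (h y)"
  using assms(2)
proof (induction rule: equivclp_induct)
  case (step y z)
  then have "equivclp s (h y) (h z)" using assms(1) equivclp_sym by metis
  with step.IH show ?case by (rule equivclp_trans)
qed simp

lemma equivclp_comtrace_split_Cons: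
  assumes "D \<in> steps \<theta>" and "equivclp (comtrace_split \<theta>) u v"
  shows "equivclp (comtrace_split \<theta>) (D # u) (D # v)"
proof (rule equivclp_map[where h = "(#) D", OF _ assms(2)])
  fix x y assume "comtrace_split \<theta> x y"
  then have "comtrace_split \<theta> (D # x) (D # y)"
  proof cases
    case (1 w z A B C)
    show ?thesis using 1 assms(1) comtrace_split.intros[of "D # w" \<theta> z A B C] by auto
  qed
  then show "equivclp (comtrace_split \<theta>) (D # x) (D # y)" by blast
qed

text \<open>Steps are nonempty, so a part of a step that turns out empty has to be dropped.\<close>

definition cons_nonempty :: "'a set \<Rightarrow> 'a set list \<Rightarrow> 'a set list" where
  "cons_nonempty A u = (if A = {} then u else A # u)"

lemma cons_nonempty_lists:
  "A \<in> insert {} (steps \<theta>) \<Longrightarrow> u \<in> lists (steps \<theta>) \<Longrightarrow> cons_nonempty A u \<in> lists (steps \<theta>)"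
  by (auto simp: cons_nonempty_def)

lemma equivclp_cons_nonempty:
  assumes "A \<in> insert {} (steps \<theta>)" and "equivclp (comtrace_split \<theta>) u v"
  shows "equivclp (comtrace_split \<theta>) (cons_nonempty A u) (cons_nonempty A v)"
  using assms equivclp_comtrace_split_Cons[OF _ assms(2), of A]
  by (cases "A = {}") (auto simp: cons_nonempty_def simp del: steps.simps)

text \<open>If \<open>B\<close> or \<open>C\<close> is empty, both sides are the same list;
  otherwise this is a generating split with empty left context.\<close>

lemma equivclp_cons_nonempty_Un:
  assumes "B \<in> insert {} (steps \<theta>)" "C \<in> insert {} (steps \<theta>)" "B \<union> C \<in> insert {} (steps \<theta>)"
    and "z \<in> lists (steps \<theta>)" "B \<times> C \<subseteq> ser_of \<theta>"
  shows "equivclp (comtrace_split \<theta>) (cons_nonempty (B \<union> C) z)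
           (cons_nonempty B (cons_nonempty C z))"
proof (cases "B = {} \<or> C = {}")
  case False
  then have "comtrace_split \<theta> ([] @ [B \<union> C] @ z) ([] @ [B, C] @ z)"
    using assms by (intro comtrace_split.intros) auto
  then show ?thesis using False by (auto simp: cons_nonempty_def)
qed (auto simp: cons_nonempty_def)

section \<open>Steps and serializability over the alphabet of an so-structure\<close>

locale finite_so_structure =
  fixes X :: "'a set" and prec sq :: "'a rel"
  assumes so: "so_structure (X, prec, sq)" and fin: "finite X"
begin

abbreviation "S \<equiv> (X, prec, sq)"
abbreviation "\<theta> \<equiv> theta S"

lemma
  shows prec_sub: "prec \<subseteq> X \<times> X" and sq_sub: "sq \<subseteq> X \<times> X" and sq_irrefl: "(a, a) \<notin> sq"
    and prec_sq: "prec \<subseteq> sq"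
    and sq_trans: "(a, b) \<in> sq \<Longrightarrow> (b, c) \<in> sq \<Longrightarrow> a \<noteq> c \<Longrightarrow> (a, c) \<in> sq"
    and sq_prec: "(a, b) \<in> sq \<Longrightarrow> (b, c) \<in> prec \<Longrightarrow> (a, c) \<in> prec"
    and prec_sq_trans: "(a, b) \<in> prec \<Longrightarrow> (b, c) \<in> sq \<Longrightarrow> (a, c) \<in> prec"
  using so_structureD[OF so] by blast+

text \<open>\<open>pairwise\<close> speaks of distinct elements only, but \<open>prec\<close> is
  irreflexive, so the condition can range over all pairs.\<close>

lemma steps_theta:
  "A \<in> steps \<theta> \<longleftrightarrow> A \<noteq> {} \<and> A \<subseteq> X \<and> (\<forall>a\<in>A. \<forall>b\<in>A. (a, b) \<notin> prec)"
proof -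
  have irr: "(a, a) \<notin> prec" for a using prec_sq sq_irrefl by blast
  have "pairwise (\<lambda>a b. (a, b) \<in> sim_so S) A \<longleftrightarrow> (\<forall>a\<in>A. \<forall>b\<in>A. (a, b) \<notin> prec)" if "A \<subseteq> X"
  proof
    assume pw: "pairwise (\<lambda>a b. (a, b) \<in> sim_so S) A"
    show "\<forall>a\<in>A. \<forall>b\<in>A. (a, b) \<notin> prec"
    proof (intro ballI)
      fix a b assume "a \<in> A" "b \<in> A"
      then show "(a, b) \<notin> prec"
        using pw irr by (cases "a = b") (auto simp: pairwise_def sim_so_def)
    qed
  next
    assume "\<forall>a\<in>A. \<forall>b\<in>A. (a, b) \<notin> prec"
    then show "pairwise (\<lambda>a b. (a, b) \<in> sim_so S) A"
      using that unfolding pairwise_def sim_so_def by auto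
  qed
  then show ?thesis
    unfolding theta_def carrier_def steps.simps fst_conv mem_Collect_eq
    by (cases "A \<subseteq> X") simp_all
qed

lemma ser_theta:
  "(a, b) \<in> ser_of \<theta> \<longleftrightarrow> a \<in> X \<and> b \<in> X \<and> a \<noteq> b \<and> (a, b) \<notin> prec \<and> (b, a) \<notin> sq"
  using prec_sq by (auto simp: theta_def ser_so_def sim_so_def)

section \<open>Admissible step sequences and their correspondence with extensions\<close>

text \<open>For subsets of \<open>X\<close>, the rectangle \<open>A \<times> B\<close> lies in
  \<open>ser\<close> iff \<open>before A B\<close> holds and no element of \<open>A\<close> is
  \<open>prec\<close>-below one of \<open>B\<close>.\<close>

definition before :: "'a set \<Rightarrow> 'a set \<Rightarrow> bool" where
  "before A B \<longleftrightarrow> (\<forall>a\<in>A. \<forall>b\<in>B. a \<noteq> b \<and> (b, a) \<notin> sq)"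

lemma before_Un:
  "before (A \<union> B) C \<longleftrightarrow> before A C \<and> before B C"
  "before C (A \<union> B) \<longleftrightarrow> before C A \<and> before C B"
  by (auto simp: before_def)

text \<open>The support \<open>Y\<close> is a parameter because inductions strip blocks and the
  separation arguments restrict to parts of \<open>X\<close>.\<close>

definition admissible :: "'a set \<Rightarrow> 'a set list \<Rightarrow> bool" where
  "admissible Y u \<longleftrightarrow> u \<in> lists (steps \<theta>) \<and> sorted_wrt before u \<and> \<Union>(set u) = Y"

lemma admissible_ordered_partition:
  assumes "admissible Y u"
  shows "ordered_partition Y u"
proof -
  have "disjnt A B" if "before A B" for A B
    using that by (auto simp: before_def disjnt_iff)
  then have "sorted_wrt disjnt u"
    using assms unfolding admissible_def by (blast intro: sorted_wrt_mono_rel)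
  then show ?thesis
    using assms by (auto simp: admissible_def ordered_partition_def steps_theta)
qed

text \<open>\<open>before\<close> forbids any \<open>sq\<close> pair from running backwards. A
  \<open>prec\<close> pair is also an \<open>sq\<close> pair and cannot share a step, so it runs
  strictly forwards.\<close>

lemma admissible_blocks_order:
  assumes "admissible X u"
  shows "blocks_order u \<in> ext S"
proof -
  note op = admissible_ordered_partition[OF assms]
  obtain f where rk: "block_index X u f"
    using ordered_partition_block_index[OF op] .
  note f = block_indexD[OF rk]
  have nsq: "(b, a) \<notin> sq" if "(a, b) \<in> blocks_order u" for a b
    using that assms by (auto simp: admissible_def blocks_order_iff sorted_wrt_iff_nth_less before_def)
  have neq: "f a \<noteq> f b" if "(a, b) \<in> prec" for a b
  proof
    assume eq: "f a = f b"
    have ab: "a \<in> X" "b \<in> X" using that prec_sub by auto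
    then have "u ! f a \<in> set u" using f(1) by simp
    then have "u ! f a \<in> steps \<theta>" using assms by (auto simp: admissible_def)
    moreover have "a \<in> u ! f a" "b \<in> u ! f a" using f eq ab by auto
    ultimately show False using that by (auto simp: steps_theta)
  qed
  have prec: "f a < f b" if ab: "(a, b) \<in> prec" for a b
  proof -
    have "(b, a) \<notin> blocks_order u" using nsq[of b a] ab prec_sq by blast
    then have "\<not> f b < f a"
      using ab prec_sub unfolding blocks_order_block_index[OF rk] by auto
    with neq[OF ab] show ?thesis by simp
  qed
  have "prec \<subseteq> blocks_order u"
    unfolding blocks_order_block_index[OF rk] using prec prec_sub by auto
  moreover have "sq \<subseteq> weak X (blocks_order u)"
  proof (rule subrelI)
    fix a b assume ab: "(a, b) \<in> sq"
    then have "a \<in> X" "b \<in> X" "a \<noteq> b" using sq_sub sq_irrefl by auto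
    then show "(a, b) \<in> weak X (blocks_order u)"
      using ab nsq[of b a] by (auto simp: weak_def)
  qed
  ultimately show ?thesis using stratified_order_blocks_order[OF op] by simp
qed

lemma ext_admissible:
  assumes "lhd \<in> ext S"
  shows "admissible X (Omega X lhd)"
proof -
  let ?u = "Omega X lhd"
  have st: "stratified_order X lhd" and p: "prec \<subseteq> lhd" and s: "sq \<subseteq> weak X lhd"
    using assms by auto
  note op = Omega_stratified_order(1)[OF fin st] and bo = Omega_stratified_order(2)[OF fin st]
  obtain f where rk: "block_index X ?u f"
    using ordered_partition_block_index[OF op] .
  note f = block_indexD[OF rk]
  have lhd: "lhd = {(a, b). a \<in> X \<and> b \<in> X \<and> f a < f b}"
    using blocks_order_block_index[OF rk] bo by simp
  have "A \<in> steps \<theta>" if A: "A \<in> set ?u" for A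
  proof -
    obtain i where "i < length ?u" "?u ! i = A" using A unfolding in_set_conv_nth by blast
    then have i: "a \<in> X \<and> f a = i" if "a \<in> A" for a using f(2) that by auto
    have "(a, b) \<notin> lhd" if "a \<in> A" "b \<in> A" for a b
      using i[OF that(1)] i[OF that(2)] unfolding lhd by simp
    moreover have "A \<noteq> {}" "A \<subseteq> X" using A op by (auto simp: ordered_partition_def)
    ultimately show ?thesis using p unfolding steps_theta by blast
  qed
  moreover have "before (?u ! i) (?u ! j)" if ij: "i < j" "j < length ?u" for i j
    unfolding before_def
  proof (intro ballI)
    fix a b assume "a \<in> ?u ! i" "b \<in> ?u ! j"
    then have "(a, b) \<in> lhd" using f(2) ij unfolding lhd by simp
    then show "a \<noteq> b \<and> (b, a) \<notin> sq" using s unfolding lhd weak_def by auto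
  qed
  ultimately show ?thesis
    using op by (auto simp: admissible_def ordered_partition_def sorted_wrt_iff_nth_less)
qed

lemma ext_sequences_eq: "ext_sequences S = {u. admissible X u}"
proof (intro equalityI subsetI)
  fix u assume "u \<in> {u. admissible X u}"
  then have u: "admissible X u" by simp
  have "u = Omega X (blocks_order u)"
    using Omega_blocks_order[OF fin admissible_ordered_partition[OF u]] by simp
  then show "u \<in> ext_sequences S"
    unfolding ext_sequences_def carrier_def fst_conv
    by (rule image_eqI) (rule admissible_blocks_order[OF u])
qed (auto simp: ext_sequences_def carrier_def ext_admissible simp del: ext.simps)

section \<open>Comtrace classes of admissible sequences\<close>

text \<open>Serializability of \<open>B \<times> C\<close> gives \<open>before B C\<close>, and
  \<open>before\<close> towards the surrounding blocks distributes over the union.\<close>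

lemma admissible_comtrace_split:
  assumes "comtrace_split \<theta> u v"
  shows "admissible Y u \<longleftrightarrow> admissible Y v"
  using assms
proof cases
  case (1 w z A B C)
  have "before B C"
    unfolding before_def
  proof (intro ballI)
    fix b c assume "b \<in> B" "c \<in> C"
    then have "(b, c) \<in> ser_of \<theta>" using 1(9) by blast
    then show "b \<noteq> c \<and> (c, b) \<notin> sq" by (simp add: ser_theta)
  qed
  then have "sorted_wrt before u \<longleftrightarrow> sorted_wrt before v"
    unfolding 1(1,2,8) by (auto simp: sorted_wrt_append before_Un)
  moreover have "u \<in> lists (steps \<theta>) \<longleftrightarrow> v \<in> lists (steps \<theta>)" "\<Union>(set u) = \<Union>(set v)"
    unfolding 1(1,2) using 1(3-8) by auto
  ultimately show ?thesis by (simp add: admissible_def)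
qed

lemma admissible_equivclp:
  assumes "equivclp (comtrace_split \<theta>) u v"
  shows "admissible Y u \<longleftrightarrow> admissible Y v"
  using assms by (induction rule: equivclp_induct) (auto simp: admissible_comtrace_split)

lemma admissible_Cons:
  "admissible Y (A # u) \<longleftrightarrow>
     A \<in> steps \<theta> \<and> admissible (Y - A) u \<and> A \<subseteq> Y \<and> before A (Y - A)"
  by (auto simp: admissible_def before_def; blast)

text \<open>In the induction \<open>B\<close> stays fixed while \<open>Y\<close> loses its first
  block \<open>A\<close>, hence the intersection \<open>B \<inter> Y\<close>. Once the rest of
  \<open>B\<close> heads the tail, \<open>A\<close> is split into \<open>A \<inter> B\<close> and
  \<open>A - B\<close>, the latter is commuted past that rest, and the two parts of \<open>B\<close>
  are merged.\<close>

lemma admissible_bring_to_front: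
  assumes "admissible Y u" "B \<in> steps \<theta>" "before B (Y - B)"
  shows "\<exists>r \<in> lists (steps \<theta>). equivclp (comtrace_split \<theta>) u (cons_nonempty (B \<inter> Y) r)"
  using assms(1,3)
proof (induction u arbitrary: Y)
  case Nil
  then show ?case by (auto simp: admissible_def cons_nonempty_def intro!: bexI[of _ "[]"])
next
  case (Cons A u)
  let ?E = "equivclp (comtrace_split \<theta>)" and ?B = "B \<inter> (Y - A)"
  have A: "A \<in> steps \<theta>" "admissible (Y - A) u" "A \<subseteq> Y" "before A (Y - A)"
    using Cons.prems(1) by (auto simp: admissible_Cons)
  have B: "before B (Y - A - B)" using Cons.prems(2) by (auto simp: before_def)
  obtain r where r: "r \<in> lists (steps \<theta>)" "?E u (cons_nonempty ?B r)"
    using Cons.IH[OF A(2) B] by blast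
  have "A' \<subseteq> X" if "A' \<in> set (A # u)" for A'
  proof -
    have "A' \<in> steps \<theta>" using that Cons.prems(1) by (auto simp: admissible_def)
    then show ?thesis by (simp add: steps_theta)
  qed
  then have YX: "Y \<subseteq> X"
    using Cons.prems(1) unfolding admissible_def by blast
  have st: "C \<in> insert {} (steps \<theta>)" if "C \<subseteq> A \<or> C \<subseteq> B" for C
    using that A(1) assms(2) unfolding insert_iff steps_theta by blast
  \<comment> \<open>In order: splitting \<open>A\<close>, merging \<open>A - B\<close> with the rest
    of \<open>B\<close>, splitting these in the opposite order, merging the parts of
    \<open>B\<close>. The middle two hold together because \<open>before A (Y - A)\<close> and
    \<open>before B (Y - B)\<close> exclude \<open>sq\<close> in opposite directions.\<close>
  have ser: "(A \<inter> B) \<times> (A - B) \<subseteq> ser_of \<theta>" "(A - B) \<times> ?B \<subseteq> ser_of \<theta>"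
    "?B \<times> (A - B) \<subseteq> ser_of \<theta>" "(A \<inter> B) \<times> ?B \<subseteq> ser_of \<theta>"
  proof -
    have np: "(a, b) \<notin> prec" if "a \<in> A \<and> b \<in> A \<or> a \<in> B \<and> b \<in> B" for a b
      using that A(1) assms(2) unfolding steps_theta by blast
    have bef: "a \<noteq> b \<and> (b, a) \<notin> sq \<and> (b, a) \<notin> prec"
      if "a \<in> A \<and> b \<in> Y - A \<or> a \<in> B \<and> b \<in> Y - B" for a b
      using that A(4) Cons.prems(2) prec_sq unfolding before_def by blast
    have serI: "(a, b) \<in> ser_of \<theta>"
      if "a \<in> A \<and> b \<in> Y - A \<or> a \<in> B \<and> b \<in> Y - B" "(a, b) \<notin> prec" for a b
      using that bef[OF that(1)] YX A(3) assms(2) unfolding ser_theta steps_theta by blast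
    show "(A \<inter> B) \<times> (A - B) \<subseteq> ser_of \<theta>" "(A \<inter> B) \<times> ?B \<subseteq> ser_of \<theta>"
      using A(3) by (auto intro!: serI np)
    show "(A - B) \<times> ?B \<subseteq> ser_of \<theta>" "?B \<times> (A - B) \<subseteq> ser_of \<theta>"
      using A(3) bef by (auto intro!: serI)
  qed
  \<comment> \<open>Commutation passes through the union as a single step, so the union must itself
    be free of \<open>prec\<close> pairs.\<close>
  have un: "A - B \<union> ?B \<in> insert {} (steps \<theta>)"
  proof -
    have "(a, b) \<notin> prec" if "(a, b) \<in> ser_of \<theta>" for a b using that by (simp add: ser_theta)
    then show ?thesis
      using A(1) assms(2) ser(2,3) unfolding insert_iff steps_theta by blast
  qed
  have cn: "cons_nonempty C z \<in> lists (steps \<theta>)" if "C \<subseteq> A \<or> C \<subseteq> B" "z \<in> lists (steps \<theta>)" for C z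
    using st[OF that(1)] that(2) by (rule cons_nonempty_lists)
  have "?E (A # u) (cons_nonempty A (cons_nonempty ?B r))"
    using equivclp_cons_nonempty[OF st r(2), of A] A(1) by (simp add: cons_nonempty_def steps_theta)
  also have "?E \<dots> (cons_nonempty (A \<inter> B) (cons_nonempty (A - B) (cons_nonempty ?B r)))"
    using equivclp_cons_nonempty_Un[OF st st _ cn ser(1), of ?B r] r(1) st[of A]
    by (simp add: Int_Diff_Un)
  also have "?E \<dots> (cons_nonempty (A \<inter> B) (cons_nonempty (A - B \<union> ?B) r))"
    by (intro equivclp_cons_nonempty st equivclp_sym[OF equivclp_cons_nonempty_Un] ser un r) auto
  also have "?E \<dots> (cons_nonempty (A \<inter> B) (cons_nonempty ?B (cons_nonempty (A - B) r)))"
    unfolding Un_commute[of "A - B"]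
    by (intro equivclp_cons_nonempty st equivclp_cons_nonempty_Un ser r
        un[unfolded Un_commute[of "A - B"]]) auto
  also have "?E \<dots> (cons_nonempty (A \<inter> B \<union> ?B) (cons_nonempty (A - B) r))"
    by (intro equivclp_sym[OF equivclp_cons_nonempty_Un] st cn ser r) auto
  also have "A \<inter> B \<union> ?B = B \<inter> Y" using A(3) by blast
  finally show ?case using cn[of "A - B" r] r(1) by blast
qed

text \<open>Bringing the first block \<open>B\<close> of \<open>v\<close> to the front turns
  \<open>u\<close> into \<open>B # r\<close>. The congruence preserves admissibility, so
  \<open>r\<close> is admissible on \<open>Y - B\<close> and can be compared with the tail of
  \<open>v\<close>.\<close>

lemma admissible_imp_equivclp:
  assumes "admissible Y u" "admissible Y v"
  shows "equivclp (comtrace_split \<theta>) u v"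
  using assms
proof (induction v arbitrary: u Y)
  case Nil
  then have "u = []" by (cases u) (auto simp: admissible_def steps_theta)
  then show ?case by simp
next
  case (Cons B v)
  have B: "B \<in> steps \<theta>" "admissible (Y - B) v" "B \<subseteq> Y" "before B (Y - B)"
    using Cons.prems(2) by (auto simp: admissible_Cons)
  obtain r where "equivclp (comtrace_split \<theta>) u (cons_nonempty (B \<inter> Y) r)"
    using admissible_bring_to_front[OF Cons.prems(1) B(1,4)] by blast
  then have r: "equivclp (comtrace_split \<theta>) u (B # r)"
    using B(1,3) by (simp add: Int_absorb2 cons_nonempty_def steps_theta)
  then have "admissible (Y - B) r"
    using admissible_equivclp Cons.prems(1) admissible_Cons by blast
  then have "equivclp (comtrace_split \<theta>) (B # r) (B # v)"
    by (intro equivclp_comtrace_split_Cons B(1) Cons.IH[OF _ B(2)])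
  with r show ?case by (rule equivclp_trans)
qed

lemma comtrace_eq:
  assumes "admissible X u"
  shows "comtrace \<theta> u = {v. admissible X v}"
  using assms admissible_equivclp[of u] admissible_imp_equivclp[OF assms]
  by (auto simp: comtrace_def) (auto simp: admissible_def)

section \<open>Separating extensions obtained by rearrangement\<close>

lemma admissible_append:
  assumes "admissible Y u" "admissible Z v" "before Y Z"
  shows "admissible (Y \<union> Z) (u @ v)"
  using assms by (auto simp: admissible_def sorted_wrt_append before_def)

text \<open>Every block is intersected with \<open>D\<close> and the empty results are dropped;
  \<open>before\<close> and freeness from \<open>prec\<close> pairs pass to subsets.\<close>

lemma admissible_restrict:
  assumes "admissible Y u"
  shows "\<exists>v. admissible (Y \<inter> D) v"
  using assms
proof (induction u arbitrary: Y)
  case Nil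
  then show ?case by (auto simp: admissible_def intro: exI[of _ "[]"])
next
  case (Cons A u)
  have A: "A \<in> steps \<theta>" "admissible (Y - A) u" "A \<subseteq> Y" "before A (Y - A)"
    using Cons.prems by (auto simp: admissible_Cons)
  obtain v where v: "admissible ((Y - A) \<inter> D) v" using Cons.IH[OF A(2)] by blast
  show ?case
  proof (cases "A \<inter> D = {}")
    case True
    then have "(Y - A) \<inter> D = Y \<inter> D" by blast
    with v show ?thesis by auto
  next
    case False
    have "(Y - A) \<inter> D = Y \<inter> D - A \<inter> D" by blast
    then have "admissible (Y \<inter> D) ((A \<inter> D) # v)"
      using v A False by (auto simp: admissible_Cons steps_theta before_def)
    then show ?thesis by blast
  qed
qed

lemma blocks_order_append:
  assumes "b \<in> \<Union>(set u)" "a \<in> \<Union>(set v)"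
  shows "(b, a) \<in> blocks_order (u @ v)"
proof -
  obtain i j where "i < length u" "b \<in> u ! i" "j < length v" "a \<in> v ! j"
    using assms by (metis UnionE in_set_conv_nth)
  then show ?thesis
    unfolding blocks_order_iff
    by (intro exI[of _ i] exI[of _ "length u + j"]) (auto simp: nth_append)
qed

lemma not_sq_separation:
  assumes u: "admissible X u" and ab: "a \<in> X" "b \<in> X" "a \<noteq> b" "(a, b) \<notin> sq"
  shows "\<exists>v. admissible X v \<and> (b, a) \<in> blocks_order v"
proof -
  \<comment> \<open>Including \<open>b\<close> makes \<open>D\<close> downward closed: an element
    \<open>sq\<close>-below a member of \<open>D\<close> is \<open>sq\<close>-below \<open>b\<close>
    or equal to \<open>b\<close>, the case that \<open>sq_trans\<close> leaves out.\<close>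
  define D where "D = {y \<in> X. y = b \<or> (y, b) \<in> sq}"
  obtain v w where vw: "admissible (X \<inter> D) v" "admissible (X \<inter> - D) w"
    using admissible_restrict[OF u] by metis
  have "before (X \<inter> D) (X \<inter> - D)"
    using sq_trans unfolding before_def D_def by blast
  then have "admissible (X \<inter> D \<union> X \<inter> - D) (v @ w)" by (rule admissible_append[OF vw])
  moreover have "X \<inter> D \<union> X \<inter> - D = X" by blast
  moreover have "(b, a) \<in> blocks_order (v @ w)"
    using vw ab by (intro blocks_order_append) (auto simp: admissible_def D_def)
  ultimately show ?thesis by auto
qed

lemma not_prec_separation:
  assumes u: "admissible X u" and ab: "(a, b) \<in> sq" "(a, b) \<notin> prec"
  shows "\<exists>v. admissible X v \<and> (a, b) \<notin> blocks_order v"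
proof -
  define D where "D = {y \<in> X. y = b \<or> (y, b) \<in> sq}"
  \<comment> \<open>\<open>C\<close> is the interval from \<open>a\<close> to \<open>b\<close>; the
    new order is \<open>D - C\<close>, then \<open>C\<close> as one block, then the complement of
    \<open>D\<close>.\<close>
  define C where "C = {y \<in> D. y = a \<or> (a, y) \<in> sq}"
  have X: "a \<in> X" "b \<in> X" using ab(1) sq_sub by auto
  have C: "a \<in> C" "b \<in> C" "C \<subseteq> X" using X ab(1) by (auto simp: C_def D_def)
  obtain v w where vw: "admissible (X \<inter> (D - C)) v" "admissible (X \<inter> - D) w"
    using admissible_restrict[OF u] by metis
  \<comment> \<open>A \<open>prec\<close> pair inside the interval would yield \<open>a\<close>
    below \<open>b\<close> in \<open>prec\<close>, by absorbing \<open>sq\<close> on both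
    sides.\<close>
  have "(x, y) \<notin> prec" if "x \<in> C" "y \<in> C" for x y
  proof
    assume "(x, y) \<in> prec"
    then have "(a, y) \<in> prec" using that sq_prec by (auto simp: C_def)
    then show False using that ab(2) prec_sq_trans by (auto simp: C_def D_def)
  qed
  then have "C \<in> steps \<theta>" using C by (auto simp: steps_theta)
  moreover have "before C (X \<inter> - D)"
    using sq_trans unfolding before_def C_def D_def by blast
  moreover have "C \<union> X \<inter> - D - C = X \<inter> - D" using C_def by blast
  ultimately have Cw: "admissible (C \<union> X \<inter> - D) (C # w)"
    using vw(2) by (auto simp: admissible_Cons)
  \<comment> \<open>An element of \<open>D\<close> lying \<open>sq\<close>-above a member of
    \<open>C\<close> is equal to \<open>a\<close> or \<open>sq\<close>-above \<open>a\<close>, hence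
    in \<open>C\<close>; and \<open>D\<close> is downward closed.\<close>
  have "before (X \<inter> (D - C)) (C \<union> X \<inter> - D)"
    using sq_trans unfolding before_def C_def D_def by blast
  then have "admissible (X \<inter> (D - C) \<union> (C \<union> X \<inter> - D)) (v @ C # w)"
    by (rule admissible_append[OF vw(1) Cw])
  moreover have "X \<inter> (D - C) \<union> (C \<union> X \<inter> - D) = X" using C(3) by blast
  ultimately have adm: "admissible X (v @ C # w)" by simp
  obtain f where rk: "block_index X (v @ C # w) f"
    using ordered_partition_block_index[OF admissible_ordered_partition[OF adm]] .
  note f = block_indexD[OF rk]
  \<comment> \<open>Indices start at 0, so the block \<open>C\<close> following \<open>v\<close> has
    index \<open>length v\<close>.\<close>
  have "f a = length v" "f b = length v"
    using f(2)[of "length v" a] f(2)[of "length v" b] C by auto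
  then have "(a, b) \<notin> blocks_order (v @ C # w)" by (simp add: blocks_order_block_index[OF rk])
  with adm show ?thesis by blast
qed

section \<open>The three structures attached to an extension\<close>

text \<open>For a pair in \<open>lhd\<close>, the extension property excludes \<open>prec\<close>
  and \<open>sq\<close> backwards, so it is serializable iff it is not in \<open>prec\<close>. For a
  pair in \<open>weak X lhd\<close>, the reversed pair is serializable iff the pair itself is not in
  \<open>sq\<close>.\<close>

lemma order_struct_eq:
  assumes "lhd \<in> ext S"
  shows "order_struct S lhd = S"
proof -
  have st: "lhd \<subseteq> X \<times> X" "irrefl lhd" "trans lhd"
    and p: "prec \<subseteq> lhd" and s: "sq \<subseteq> weak X lhd"
    using assms by (auto simp: stratified_order_def)
  have asym: "(b, a) \<notin> lhd" if "(a, b) \<in> lhd" for a b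
    using st that by (meson irreflD transD)
  have "lhd - ser_so S = prec"
    using st asym p s by (auto simp: ser_so_def sim_so_def weak_def irrefl_def)
  moreover have "weak X lhd - (ser_so S)\<inverse> = sq"
    using prec_sq p s by (auto simp: ser_so_def sim_so_def weak_def)
  ultimately show ?thesis by (simp add: order_struct_def carrier_def)
qed

lemma seq_struct_eq:
  assumes "lhd \<in> ext S"
  shows "seq_struct \<theta> (Omega X lhd) = first_occurrences S"
proof -
  let ?u = "Omega X lhd"
  have op: "ordered_partition X ?u" and bo: "blocks_order ?u = lhd"
    using Omega_stratified_order[OF fin] assms by auto
  have lhd: "prec = lhd - ser_of \<theta>" "sq = weak X lhd - (ser_of \<theta>)\<inverse>"
    using order_struct_eq[OF assms] by (auto simp: order_struct_def theta_def carrier_def)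
  have "(occs ?u, seq_prec \<theta> ?u, seq_sq \<theta> ?u) = first_occurrences S"
    unfolding seq_prec_def seq_sq_def occs_ordered_partition[OF op]
      seq_lhd_ordered_partition[OF op] seq_weak_ordered_partition[OF op] bo
    \<comment> \<open>\<open>prec\<close> and \<open>sq\<close> also occur inside
      \<open>\<theta>\<close>, so each equation rewrites a single occurrence only.\<close>
    by (subst (3) lhd(1), subst (3) lhd(2)) auto
  then show ?thesis
    unfolding seq_struct_def using so_structure_first_occurrences[OF so]
    by (metis lozenge_so_structure prod_cases3)
qed

text \<open>By \<open>comtrace_eq\<close> the intersections range over all admissible sequences.
  Each of these extends \<open>S\<close>, and the separation lemmas exclude every further
  pair.\<close>

lemma comtrace_struct_eq:
  assumes u: "admissible X u"
  shows "comtrace_struct \<theta> u = first_occurrences S"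
proof -
  note op = admissible_ordered_partition
  have ext: "prec \<subseteq> blocks_order v" "sq \<subseteq> weak X (blocks_order v)" if "admissible X v" for v
    using admissible_blocks_order[OF that] by auto
  have lhd: "((a, n), (b, m)) \<in> seq_lhd v \<longleftrightarrow> n = 1 \<and> m = 1 \<and> (a, b) \<in> blocks_order v"
    and weak: "((a, n), (b, m)) \<in> seq_weak v \<longleftrightarrow> n = 1 \<and> m = 1 \<and> (a, b) \<in> weak X (blocks_order v)"
    if "admissible X v" for v a b n m
    unfolding seq_lhd_ordered_partition[OF op[OF that]] seq_weak_ordered_partition[OF op[OF that]]
    by auto
  have sq: "(a, b) \<in> sq" if "\<And>v. admissible X v \<Longrightarrow> (a, b) \<in> weak X (blocks_order v)" for a b
    using that[OF u] that not_sq_separation[OF u, of a b] by (auto simp: weak_def)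
  have prec: "(a, b) \<in> prec" if all: "\<And>v. admissible X v \<Longrightarrow> (a, b) \<in> blocks_order v" for a b
  proof -
    \<comment> \<open>Passing to the weak relation first yields \<open>(a, b) \<in> sq\<close>, the
      premise under which \<open>not_prec_separation\<close> applies.\<close>
    have "(a, b) \<in> weak X (blocks_order v)" if "admissible X v" for v
      using all[OF that] stratified_order_blocks_order[OF op[OF that]]
      unfolding stratified_order_def weak_def by (auto dest: irreflD transD)
    then show ?thesis using sq not_prec_separation[OF u] all by blast
  qed
  have "(\<Inter>v \<in> {v. admissible X v}. seq_lhd v) = {((a, 1), (b, 1)) |a b. (a, b) \<in> prec}"
    using u lhd ext(1) prec by (auto; blast)
  moreover have "(\<Inter>v \<in> {v. admissible X v}. seq_weak v) = {((a, 1), (b, 1)) |a b. (a, b) \<in> sq}"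
    using u weak ext(2) sq by (auto; blast)
  ultimately show ?thesis
    unfolding comtrace_struct_def comtrace_eq[OF u] occs_ordered_partition[OF op[OF u]] by simp
qed

end

theorem theorem10p3:
  fixes S :: "'a relstruct" and lhd :: "'a rel"
  assumes "so_structure S"
    and "finite (carrier S)"
    and "lhd \<in> ext S"
  shows "(comtrace_struct (theta S) (Omega (carrier S) lhd)
            = seq_struct (theta S) (Omega (carrier S) lhd) \<and>
          seq_struct (theta S) (Omega (carrier S) lhd)
            = first_occurrences (order_struct S lhd) \<and>
          order_struct S lhd = S) \<and>
         ext_sequences S = comtrace (theta S) (Omega (carrier S) lhd)"
proof -
  obtain X prec sq where S: "S = (X, prec, sq)" by (cases S)
  interpret finite_so_structure X prec sq
    using assms unfolding S carrier_def fst_conv by unfold_locales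
  have lhd: "lhd \<in> ext (X, prec, sq)" and X: "carrier (X, prec, sq) = X"
    using assms(3) by (simp_all add: S carrier_def)
  show ?thesis
    unfolding S X
    using comtrace_struct_eq[OF ext_admissible[OF lhd]] seq_struct_eq[OF lhd]
      order_struct_eq[OF lhd] ext_sequences_eq comtrace_eq[OF ext_admissible[OF lhd]]
    by simp
qed

end
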